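(* For $D\ge1$ let $\mathbb V(D):=\sup\{|u(0)|^2:\ u\in H^1_{\mathrm{per}}(0,2\pi),\ \int_0^{2\pi}u\,dx=0,\ \|u\|^2=1,\ \|u'\|^2=D\}$ and, for $\lambda>-1$, $G(\lambda):=\frac1{2\pi}\sum_{k\in\mathbb Z_0}\frac1{\lambda+k^2}$. Then for every fixed $D\ge1$ $$\mathbb V(D)=\min_{\lambda\in[-1,\infty)}(\lambda+D)G(\lambda),$$ where $G(-1):=+\infty$.
   Context: Functions are complex-valued and $2\pi$-periodic; $\|\cdot\|$ is the $L_2(0,2\pi)$ norm; $\mathbb Z_0=\mathbb Z\setminus\{0\}$.
   Formalization: At λ = −1 the value of (λ+D)G(λ) is taken as its limit from the right (+∞ for D > 1, 1/π for D = 1), because for D = 1 the product 0·(+∞) given by G(−1) := +∞ is undefined. *)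

theory Defs
  imports "HOL-Analysis.Analysis"
begin

text \<open>Periodic Sobolev space H^1_per(0,2pi), complex valued: u is 2pi-periodic and
  absolutely continuous on [0,2pi] with derivative v in L2(0,2pi), i.e.
  u x = u 0 + integral from 0 to x of v.  The function v plays the role of u'.\<close>
definition H1per :: "(real \<Rightarrow> complex) \<Rightarrow> (real \<Rightarrow> complex) \<Rightarrow> bool" where
  "H1per u v \<longleftrightarrow>
     (\<forall>x. u (x + 2*pi) = u x) \<and>
     v absolutely_integrable_on {0..2*pi} \<and>
     (\<lambda>x. (cmod (v x))\<^sup>2) integrable_on {0..2*pi} \<and>
     (\<forall>x\<in>{0..2*pi}. u x = u 0 + integral {0..x} v)"

definition L2sq :: "(real \<Rightarrow> complex) \<Rightarrow> real" where
  "L2sq f = integral {0..2*pi} (\<lambda>x. (cmod (f x))\<^sup>2)"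

definition VV :: "real \<Rightarrow> real" where
  "VV D = Sup {(cmod (u 0))\<^sup>2 | u. \<exists>v. H1per u v \<and> integral {0..2*pi} u = 0
                \<and> L2sq u = 1 \<and> L2sq v = D}"

definition GG :: "real \<Rightarrow> real" where
  "GG l = (1 / (2*pi)) * (\<Sum>\<^sub>\<infinity>k\<in>{k::int. k \<noteq> 0}. 1 / (l + (of_int k)\<^sup>2))"

text \<open>(l + D) G(l) on [-1,\<infinity>), extended-real valued; at l = -1 (where G = +\<infinity>)
  the value is the one-sided limit from the right.\<close>
definition FF :: "real \<Rightarrow> real \<Rightarrow> ereal" where
  "FF D l = (if l = -1 then Lim (at_right (-1)) (\<lambda>m. ereal ((m + D) * GG m))
             else ereal ((l + D) * GG l))"

end

theory Submission
  imports Defs "HOL-Real_Asymp.Real_Asymp"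
begin

text \<open>Let a(k) be the Fourier coefficients of u. For every m > -1 the Cauchy-Schwarz inequality,
  applied to the products of 1 / sqrt (m + k^2) and sqrt (m + k^2) a(k), gives
  |u(0)|^2 \<le> (m + D) G(m). Parseval for u, which is needed with equality because m may be negative,
  and convergence of the Fourier series at 0 both come from the representation of 2\<pi> u(y) as the
  integral of u' against a sawtooth with a jump at y, whose Fourier remainder tends to 0 in L2
  uniformly in y by the Basel series.

  Conversely, for D > 1 the coefficients 1 / (l + k^2) are extremal once the sum of
  (k^2 - D) / (l + k^2)^2 vanishes, and such an l exists by the intermediate value theorem. A cosine
  polynomial truncating the extremal series is made admissible by adding two sine modes, which
  vanish at 0. For D = 1 the minimum is the limit at -1, and cos is extremal.\<close>

section \<open>Integration by parts for indefinite integrals\<close>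

lemma absolutely_integrable_continuous_mult:
  fixes g v :: "real \<Rightarrow> complex"
  assumes "continuous_on {a..b} g" "v absolutely_integrable_on {a..b}"
  shows "(\<lambda>x. g x * v x) absolutely_integrable_on {a..b}"
proof (rule absolutely_integrable_bounded_measurable_product[where h = "(*)"])
  show "g \<in> borel_measurable (lebesgue_on {a..b})"
    using assms(1) by (intro continuous_imp_measurable_on_sets_lebesgue) auto
  show "bounded (g ` {a..b})"
    using assms(1) compact_continuous_image compact_imp_bounded by blast
qed (use assms in \<open>auto intro: bilinear_times\<close>)

text \<open>Since \<open>u\<close> is only an indefinite integral, the product rule fails pointwise
  in general. Instead the defect of the formula is viewed as a function of the right endpoint, and
  its derivative is shown to vanish everywhere.\<close>

lemma integral_by_parts_indefinite:
  fixes u v g g' :: "real \<Rightarrow> complex"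
  assumes ab: "a \<le> b"
    and v: "v absolutely_integrable_on {a..b}"
    and u: "\<And>x. x \<in> {a..b} \<Longrightarrow> u x = u a + integral {a..x} v"
    and g: "\<And>x. x \<in> {a..b} \<Longrightarrow> (g has_vector_derivative g' x) (at x within {a..b})"
    and g': "continuous_on {a..b} g'"
  shows "integral {a..b} (\<lambda>x. g x * v x) =
           g b * u b - g a * u a - integral {a..b} (\<lambda>x. g' x * u x)"
proof -
  have vi: "v integrable_on {a..b}" and ni: "(\<lambda>x. norm (v x)) integrable_on {a..b}"
    using v absolutely_integrable_on_def by blast+
  have cg: "continuous_on {a..b} g"
    using g has_vector_derivative_continuous continuous_on_eq_continuous_within by blast
  have "continuous_on {a..b} (\<lambda>x. u a + integral {a..x} v)"
    by (intro continuous_on_add continuous_on_const indefinite_integral_continuous_1 vi)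
  then have cu: "continuous_on {a..b} u"
    using u by (metis (mono_tags, lifting) continuous_on_cong)
  have gv: "(\<lambda>x. g x * v x) integrable_on {a..b}"
    using absolutely_integrable_continuous_mult[OF cg v] absolutely_integrable_on_def by blast
  have gu: "(\<lambda>x. g' x * u x) integrable_on {a..b}"
    by (intro integrable_continuous_real continuous_intros g' cu)
  obtain M where M: "M > 0" "\<And>x. x \<in> {a..b} \<Longrightarrow> norm (g' x) \<le> M"
  proof -
    have "bounded (g' ` {a..b})"
      using g' compact_continuous_image compact_imp_bounded by blast
    then show ?thesis using that unfolding bounded_pos by auto
  qed
  define V where "V x = integral {a..x} (\<lambda>t. norm (v t))" for x
  txt \<open>The function u need not be differentiable, but the defect of the formula on [x, y] is
    O(y - x) times the integral of |v| over [x, y], hence has derivative 0.\<close>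
  define \<Phi> where "\<Phi> x = integral {a..x} (\<lambda>t. g t * v t) - g x * u x
      + integral {a..x} (\<lambda>t. g' t * u t)" for x
  have split: "integral {a..y} f - integral {a..x} f = integral {x..y} f"
    if "f integrable_on {a..b}" "a \<le> x" "x \<le> y" "y \<le> b"
    for f :: "real \<Rightarrow> 'z::euclidean_space" and x y
    using Henstock_Kurzweil_Integration.integral_combine[of a x y f] that
      integrable_subinterval_real[of f a b a y] by (simp add: algebra_simps)
  have sub: "f integrable_on {x..y}" if "f integrable_on {a..b}" "a \<le> x" "y \<le> b"
    for f :: "real \<Rightarrow> 'z::euclidean_space" and x y
    using integrable_subinterval_real[of f a b x y] that by simp
  have est: "norm (\<Phi> y - \<Phi> x) \<le> 2 * M * (y - x) * (V y - V x)"
    if xy: "a \<le> x" "x \<le> y" "y \<le> b" for x y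
  proof -
    have "u y - u x = integral {x..y} v"
      using u[of x] u[of y] split[OF vi xy] xy by simp
    have g'x: "integral {x..y} g' = g y - g x"
      by (intro integral_unique fundamental_theorem_of_calculus)
        (use xy g has_vector_derivative_within_subset[OF g] in auto)
    have g'i: "g' integrable_on {x..y}"
      by (intro integrable_continuous_real continuous_on_subset[OF g']) (use xy in auto)
    have gvi: "(\<lambda>t. g t * v t) integrable_on {x..y}" "v integrable_on {x..y}"
       "(\<lambda>t. g' t * u t) integrable_on {x..y}" "(\<lambda>x. norm (v x)) integrable_on {x..y}"
      using gv vi gu ni sub xy by blast+
    have i1: "(\<lambda>t. g t * v t - g y * v t) integrable_on {x..y}"
      by (intro integrable_diff gvi integrable_on_mult_right)
    have i2: "(\<lambda>t. g' t * u t - g' t * u x) integrable_on {x..y}"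
      by (intro integrable_diff gvi integrable_on_mult_left g'i)
    have "\<Phi> y - \<Phi> x = integral {x..y} (\<lambda>t. g t * v t) + integral {x..y} (\<lambda>t. g' t * u t)
        - g y * u y + g x * u x"
      unfolding \<Phi>_def split[OF gv xy, symmetric] split[OF gu xy, symmetric] by simp
    \<comment> \<open>Freezing \<open>g\<close> at the right endpoint and \<open>u\<close> at the
      left one makes the boundary terms cancel exactly: \<open>g y * (u y - u x) + (g y - g x) * u x
      = g y * u y - g x * u x\<close>.\<close>
    also have "\<dots> = integral {x..y} (\<lambda>t. g t * v t - g y * v t)
        + integral {x..y} (\<lambda>t. g' t * u t - g' t * u x)"
    proof -
      have "integral {x..y} (\<lambda>t. g t * v t - g y * v t) =
          integral {x..y} (\<lambda>t. g t * v t) - g y * (u y - u x)"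
        by (subst integral_diff) (auto intro: gvi integrable_on_mult_right simp: \<open>u y - u x = _\<close>)
      moreover have "integral {x..y} (\<lambda>t. g' t * u t - g' t * u x) =
          integral {x..y} (\<lambda>t. g' t * u t) - (g y - g x) * u x"
        by (subst integral_diff) (auto intro: gvi integrable_on_mult_left g'i simp: g'x)
      ultimately show ?thesis by (simp only:) (simp add: algebra_simps)
    qed
    also have "norm \<dots> \<le> M * (y - x) * (V y - V x) + M * (V y - V x) * (y - x)"
    proof (rule norm_triangle_mono)
      have "norm (integral {x..y} (\<lambda>t. g t * v t - g y * v t))
          \<le> integral {x..y} (\<lambda>t. M * (y - x) * norm (v t))"
      proof (rule integral_norm_bound_integral[OF i1])
        show "(\<lambda>t. M * (y - x) * norm (v t)) integrable_on {x..y}"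
          by (intro integrable_on_mult_right gvi)
        fix t assume t: "t \<in> {x..y}"
        have "integral {t..y} g' = g y - g t"
          by (intro integral_unique fundamental_theorem_of_calculus)
            (use xy t has_vector_derivative_within_subset[OF g] in auto)
        moreover have "norm (integral {t..y} g') \<le> M * (y - t)"
          by (rule integral_bound) (use t xy M continuous_on_subset[OF g'] in auto)
        ultimately have "norm (g t - g y) \<le> M * (y - t)"
          by (simp add: norm_minus_commute)
        also have "\<dots> \<le> M * (y - x)"
          using t M(1) by simp
        finally have "norm (g t - g y) \<le> M * (y - x)" .
        then show "norm (g t * v t - g y * v t) \<le> M * (y - x) * norm (v t)"
          by (metis left_diff_distrib mult_right_mono norm_ge_zero norm_mult)
      qed
      then show "norm (integral {x..y} (\<lambda>t. g t * v t - g y * v t)) \<le> M * (y - x) * (V y - V x)"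
        using split[OF ni xy] unfolding V_def by simp
      have "norm (integral {x..y} (\<lambda>t. g' t * u t - g' t * u x))
          \<le> integral {x..y} (\<lambda>t. M * (V y - V x))"
      proof (rule integral_norm_bound_integral[OF i2])
        fix t assume t: "t \<in> {x..y}"
        have "u t - u x = integral {x..t} v"
          using u[of x] u[of t] split[OF vi, of x t] xy t by simp
        then have "norm (u t - u x) \<le> integral {x..t} (\<lambda>x. norm (v x))"
          using integral_norm_bound_integral[of v "{x..t}" "\<lambda>x. norm (v x)"]
             sub[OF vi, of x t] sub[OF ni, of x t] t xy by auto
        also have "\<dots> \<le> integral {x..y} (\<lambda>x. norm (v x))"
          by (rule integral_subset_le) (use t xy sub[OF ni] in auto)
        also have "\<dots> = V y - V x"
          using split[OF ni xy] unfolding V_def by simp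
        finally have "norm (u t - u x) \<le> V y - V x" .
        then show "norm (g' t * u t - g' t * u x) \<le> M * (V y - V x)"
          using M t xy unfolding right_diff_distrib[symmetric] norm_mult
          by (intro mult_mono) auto
      qed auto
      then show "norm (integral {x..y} (\<lambda>t. g' t * u t - g' t * u x)) \<le> M * (V y - V x) * (y - x)"
        using xy by (simp add: mult_ac)
    qed
    finally show ?thesis by (simp add: algebra_simps)
  qed
  have cV: "continuous_on {a..b} V"
    unfolding V_def by (rule indefinite_integral_continuous_1[OF ni])
  \<comment> \<open>After division by \<open>norm (y - x)\<close> the estimate leaves a multiple of
    the increment of \<open>V\<close>, which tends to 0 because \<open>V\<close> is
    continuous.\<close>
  have "(\<Phi> has_derivative (\<lambda>h. 0)) (at x within {a..b})" if x: "x \<in> {a..b}" for x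
  proof (rule has_derivativeI_sandwich[of 1 _ _ _ _ "\<lambda>y. 2 * M * \<bar>V y - V x\<bar>"])
    show "norm (\<Phi> y - \<Phi> x - 0) / norm (y - x) \<le> 2 * M * \<bar>V y - V x\<bar>"
      if y: "y \<in> {a..b}" "y \<noteq> x" for y
    proof -
      have "norm (\<Phi> y - \<Phi> x) \<le> 2 * M * \<bar>V y - V x\<bar> * norm (y - x)"
      proof (cases "x \<le> y")
        case True
        then have "2 * M * (y - x) * (V y - V x) \<le> 2 * M * (y - x) * \<bar>V y - V x\<bar>"
          using M by (intro mult_left_mono) auto
        with True est[of x y] x y show ?thesis by (simp add: algebra_simps)
      next
        case False
        then have "2 * M * (x - y) * (V x - V y) \<le> 2 * M * (x - y) * \<bar>V y - V x\<bar>"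
          using M by (intro mult_left_mono) auto
        with False est[of y x] x y show ?thesis by (simp add: algebra_simps norm_minus_commute)
      qed
      then show ?thesis using y by (simp add: field_simps)
    qed
    have "((\<lambda>y. 2 * M * \<bar>V y - V x\<bar>) \<longlongrightarrow> 2 * M * \<bar>V x - V x\<bar>) (at x within {a..b})"
      by (intro tendsto_intros) (use cV x in \<open>auto simp: continuous_on_def\<close>)
    then show "((\<lambda>y. 2 * M * \<bar>V y - V x\<bar>) \<longlongrightarrow> 0) (at x within {a..b})" by simp
  qed auto
  then obtain c where c: "\<And>x. x \<in> {a..b} \<Longrightarrow> \<Phi> x = c"
    using has_derivative_zero_constant[of "{a..b}" \<Phi>] by auto
  have "\<Phi> b = \<Phi> a" using c ab by simp
  then show ?thesis unfolding \<Phi>_def by (simp add: algebra_simps)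
qed

section \<open>Fourier coefficients on a period\<close>

text \<open>Membership in L2 on one period. Absolute integrability supplies the measurability of
  \<open>f\<close> itself, which integrability of its squared modulus does not give.\<close>

definition sq_integrable :: "(real \<Rightarrow> complex) \<Rightarrow> bool" where
  "sq_integrable f \<longleftrightarrow> f absolutely_integrable_on {0..2*pi} \<and>
     (\<lambda>x. (cmod (f x))\<^sup>2) integrable_on {0..2*pi}"

definition ek :: "int \<Rightarrow> real \<Rightarrow> complex" where
  "ek k x = cis (of_int k * x)"

definition fourier_coeff :: "(real \<Rightarrow> complex) \<Rightarrow> int \<Rightarrow> complex" where
  "fourier_coeff f k = integral {0..2*pi} (\<lambda>x. ek (-k) x * f x) / (2*pi)"

lemma ek_mult: "ek j x * ek k x = ek (j + k) x"
  by (simp add: ek_def cis_mult algebra_simps)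

lemma ek_zero [simp]: "ek 0 x = 1"
  by (simp add: ek_def)

lemma ek_at_0 [simp]: "ek k 0 = 1"
  by (simp add: ek_def)

lemma ek_periodic [simp]: "ek k (x + 2*pi) = ek k x"
proof -
  have "ek k (x + 2*pi) = cis (of_int k * x) * cis (2 * pi * of_int k)"
    unfolding ek_def cis_mult by (simp add: algebra_simps)
  then show ?thesis by (simp add: ek_def)
qed

lemma ek_at_2pi [simp]: "ek k (2*pi) = 1"
  using ek_periodic[of k 0] by simp

lemma cnj_ek: "cnj (ek k x) = ek (-k) x"
  by (simp add: ek_def cis_cnj)

lemma norm_ek [simp]: "cmod (ek k x) = 1"
  by (simp add: ek_def)

lemma has_vector_derivative_ek:
  "(ek k has_vector_derivative (\<i> * of_int k * ek k x)) (at x within S)"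
  unfolding has_vector_derivative_def ek_def
  by (rule derivative_eq_intros refl | simp add: scaleR_conv_of_real mult_ac)+

lemma continuous_on_ek: "continuous_on S (ek k)"
  unfolding ek_def by (intro continuous_intros)

lemma has_integral_ek:
  assumes "0 \<le> x" "k \<noteq> 0"
  shows "(ek k has_integral (ek k x - 1) / (\<i> * of_int k)) {0..x}"
proof -
  have "((\<lambda>x. ek k x / (\<i> * of_int k)) has_vector_derivative ek k x) (at x within S)" for x S
    using has_vector_derivative_divide[OF has_vector_derivative_ek[of k x S], of "\<i> * of_int k"] assms
    by simp
  from fundamental_theorem_of_calculus[OF assms(1) this]
  show ?thesis by (simp add: diff_divide_distrib)
qed

lemma has_integral_ek_period: "(ek k has_integral (if k = 0 then 2*pi else 0)) {0..2*pi}"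
proof (cases "k = 0")
  case True
  moreover have "ek 0 = (\<lambda>_. 1)" by auto
  ultimately show ?thesis
    using has_integral_const_real[of "1::complex" 0 "2*pi"] by (simp add: scaleR_conv_of_real)
qed (use has_integral_ek[of "2*pi" k] in simp)

lemma sq_integrable_continuous:
  "continuous_on {0..2*pi} f \<Longrightarrow> sq_integrable f"
  unfolding sq_integrable_def
  by (intro conjI absolutely_integrable_continuous_real integrable_continuous_real continuous_intros)

lemma has_integral_fourier_coeff:
  assumes "sq_integrable f"
  shows "((\<lambda>x. ek k x * f x) has_integral (2*pi * fourier_coeff f (-k))) {0..2*pi}"
proof -
  have "(\<lambda>x. ek k x * f x) integrable_on {0..2*pi}"
    using absolutely_integrable_continuous_mult[OF continuous_on_ek] assms
    unfolding sq_integrable_def absolutely_integrable_on_def by blast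
  then show ?thesis
    by (simp add: fourier_coeff_def has_integral_integral)
qed

text \<open>The squared modulus expands into a double sum of exponentials, of which only the
  diagonal survives integration.\<close>

lemma has_integral_trig_sum_norm:
  assumes "finite K"
  shows "((\<lambda>x. (cmod (\<Sum>k\<in>K. a k * ek k x))\<^sup>2) has_integral 2*pi * (\<Sum>k\<in>K. (cmod (a k))\<^sup>2)) {0..2*pi}"
proof -
  have "((\<lambda>x. \<Sum>k\<in>K. \<Sum>j\<in>K. a k * cnj (a j) * ek (k - j) x) has_integral
      (\<Sum>k\<in>K. \<Sum>j\<in>K. a k * cnj (a j) * complex_of_real (if k - j = 0 then 2*pi else 0))) {0..2*pi}"
    by (intro has_integral_sum assms has_integral_mult_right has_integral_ek_period)
  also have "(\<Sum>k\<in>K. \<Sum>j\<in>K. a k * cnj (a j) * complex_of_real (if k - j = 0 then 2*pi else 0))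
      = (\<Sum>k\<in>K. a k * cnj (a k) * complex_of_real (2*pi))"
    using assms by (intro sum.cong refl) (simp add: if_distrib cong: if_cong)
  also have "\<dots> = complex_of_real (2*pi * (\<Sum>k\<in>K. (cmod (a k))\<^sup>2))"
    by (simp add: complex_norm_square[unfolded of_real_power] sum_distrib_left mult_ac)
  also have "(\<lambda>x. \<Sum>k\<in>K. \<Sum>j\<in>K. a k * cnj (a j) * ek (k - j) x) =
      (\<lambda>x. complex_of_real ((cmod (\<Sum>k\<in>K. a k * ek k x))\<^sup>2))"
  proof
    fix x
    have "a k * cnj (a j) * ek (k - j) x = (a k * ek k x) * cnj (a j * ek j x)" for k j
      using ek_mult[of k x "-j"] by (simp add: cnj_ek mult_ac)
    then show "(\<Sum>k\<in>K. \<Sum>j\<in>K. a k * cnj (a j) * ek (k - j) x) =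
        complex_of_real ((cmod (\<Sum>k\<in>K. a k * ek k x))\<^sup>2)"
      unfolding complex_norm_square cnj_sum sum_product by (simp only:)
  qed
  finally have "((\<lambda>x. complex_of_real ((cmod (\<Sum>k\<in>K. a k * ek k x))\<^sup>2)) has_integral
      complex_of_real (2*pi * (\<Sum>k\<in>K. (cmod (a k))\<^sup>2))) {0..2*pi}" .
  from has_integral_Re[OF this] show ?thesis
    by (simp only: Re_complex_of_real)
qed

lemma sq_norm_diff: "(cmod (a - b))\<^sup>2 = (cmod a)\<^sup>2 - 2 * Re (cnj b * a) + (cmod b)\<^sup>2"
  by (simp only: cmod_power2) (simp add: power2_eq_square algebra_simps)

text \<open>Expanding the square, the cross term contributes the coefficient sum twice with a minus
  sign and the polynomial contributes it once. The exact value, not just an inequality, is what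
  later gives the remainder of the sawtooth.\<close>

lemma bessel_identity:
  assumes f: "sq_integrable f" and K: "finite K"
  shows "((\<lambda>x. (cmod (f x - (\<Sum>k\<in>K. fourier_coeff f k * ek k x)))\<^sup>2) has_integral
           (L2sq f - 2*pi * (\<Sum>k\<in>K. (cmod (fourier_coeff f k))\<^sup>2))) {0..2*pi}"
proof -
  let ?c = "fourier_coeff f"
  have "((\<lambda>x. \<Sum>k\<in>K. cnj (?c k) * (ek (-k) x * f x)) has_integral
      (\<Sum>k\<in>K. cnj (?c k) * (2*pi * ?c (- (-k))))) {0..2*pi}"
    by (intro has_integral_sum K has_integral_mult_right has_integral_fourier_coeff f)
  also have "(\<lambda>x. \<Sum>k\<in>K. cnj (?c k) * (ek (-k) x * f x)) =
      (\<lambda>x. cnj (\<Sum>k\<in>K. ?c k * ek k x) * f x)"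
    by (simp add: sum_distrib_right cnj_ek mult.assoc)
  also have "(\<Sum>k\<in>K. cnj (?c k) * (2*pi * ?c (- (-k)))) = complex_of_real (2*pi * (\<Sum>k\<in>K. (cmod (?c k))\<^sup>2))"
    by (simp add: complex_norm_square[unfolded of_real_power] sum_distrib_left mult_ac)
  finally have "((\<lambda>x. cnj (\<Sum>k\<in>K. ?c k * ek k x) * f x) has_integral
       complex_of_real (2*pi * (\<Sum>k\<in>K. (cmod (?c k))\<^sup>2))) {0..2*pi}" .
  from has_integral_Re[OF this]
  have i: "((\<lambda>x. Re (cnj (\<Sum>k\<in>K. ?c k * ek k x) * f x)) has_integral
       2*pi * (\<Sum>k\<in>K. (cmod (?c k))\<^sup>2)) {0..2*pi}"
    by (simp only: Re_complex_of_real)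
  have "((\<lambda>x. (cmod (f x))\<^sup>2) has_integral L2sq f) {0..2*pi}"
    using f unfolding sq_integrable_def L2sq_def by (simp add: has_integral_integral)
  then have "((\<lambda>x. (cmod (f x))\<^sup>2 - 2 * Re (cnj (\<Sum>k\<in>K. ?c k * ek k x) * f x)
        + (cmod (\<Sum>k\<in>K. ?c k * ek k x))\<^sup>2)
      has_integral (L2sq f - 2 * (2*pi * (\<Sum>k\<in>K. (cmod (?c k))\<^sup>2))
        + 2*pi * (\<Sum>k\<in>K. (cmod (?c k))\<^sup>2))) {0..2*pi}"
    by (intro has_integral_add has_integral_diff has_integral_mult_right i
          has_integral_trig_sum_norm K)
  then show ?thesis
    unfolding sq_norm_diff by (rule has_integral_eq_rhs) simp
qed

lemma bessel_inequality:
  assumes "sq_integrable f" "finite K"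
  shows "2*pi * (\<Sum>k\<in>K. (cmod (fourier_coeff f k))\<^sup>2) \<le> L2sq f"
  using has_integral_nonneg[OF bessel_identity[OF assms]] by simp

text \<open>The weighted arithmetic-geometric mean inequality holds pointwise with any weight s > 0;
  integrating it and optimising over s gives the claim.\<close>

lemma integral_cauchy_schwarz:
  assumes f: "(\<lambda>x. (cmod (f x))\<^sup>2) integrable_on {0..2*pi}"
    and g: "(\<lambda>x. (cmod (g x))\<^sup>2) integrable_on {0..2*pi}"
    and fg: "(\<lambda>x. f x * g x) integrable_on {0..2*pi}"
  shows "(cmod (integral {0..2*pi} (\<lambda>x. f x * g x)))\<^sup>2 \<le> L2sq f * L2sq g"
proof -
  define z where "z = cmod (integral {0..2*pi} (\<lambda>x. f x * g x))"
  have nn: "L2sq f \<ge> 0" "L2sq g \<ge> 0" "z \<ge> 0"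
    unfolding L2sq_def z_def by (auto intro: integral_nonneg f g)
  have key: "2 * s * z \<le> s\<^sup>2 * L2sq f + L2sq g" if s: "s > 0" for s
  proof -
    have "z \<le> integral {0..2*pi} (\<lambda>x. s / 2 * (cmod (f x))\<^sup>2 + 1 / (2 * s) * (cmod (g x))\<^sup>2)"
      unfolding z_def
    proof (rule integral_norm_bound_integral[OF fg])
      show "(\<lambda>x. s / 2 * (cmod (f x))\<^sup>2 + 1 / (2 * s) * (cmod (g x))\<^sup>2) integrable_on {0..2*pi}"
        by (intro integrable_add integrable_on_mult_right f g)
      fix x
      have "0 \<le> (s * cmod (f x) - cmod (g x))\<^sup>2 / (2 * s)" using s by simp
      also have "\<dots> = s / 2 * (cmod (f x))\<^sup>2 + 1 / (2 * s) * (cmod (g x))\<^sup>2 - cmod (f x * g x)"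
        using s by (simp add: field_simps power2_eq_square norm_mult)
      finally show "cmod (f x * g x) \<le> s / 2 * (cmod (f x))\<^sup>2 + 1 / (2 * s) * (cmod (g x))\<^sup>2"
        by simp
    qed
    also have "\<dots> = s / 2 * L2sq f + 1 / (2 * s) * L2sq g"
      unfolding L2sq_def
      by (subst integral_add) (auto intro!: integrable_on_mult_right f g simp del: times_divide_eq_left)
    finally show ?thesis using s by (simp add: field_simps power2_eq_square)
  qed
  have "z\<^sup>2 \<le> L2sq f * L2sq g"
  proof (cases "L2sq f = 0 \<or> z = 0")
    case True
    then show ?thesis
    proof (cases "z = 0")
      case False
      then have "L2sq f = 0" "z > 0" using True nn by auto
      \<comment> \<open>If \<open>f\<close> has norm 0, the inequality bounds 2 s z for every s, so
        a large enough s contradicts z > 0.\<close>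
      then have "2 * L2sq g + 2 \<le> L2sq g"
        using key[of "(L2sq g + 1) / z"] nn by simp
      then show ?thesis using nn by simp
    qed (use nn in simp)
  next
    case False
    then have pos: "L2sq f > 0" "z > 0" using nn by auto
    \<comment> \<open>The weight \<open>z / L2sq f\<close> maximises
      \<open>2 * s * z - s\<^sup>2 * L2sq f\<close>.\<close>
    have "2 * (z / L2sq f) * z \<le> (z / L2sq f)\<^sup>2 * L2sq f + L2sq g"
      using pos by (intro key) simp
    also have "(z / L2sq f)\<^sup>2 * L2sq f = (z / L2sq f) * z"
      using pos by (simp add: power2_eq_square)
    finally have "z * z / L2sq f \<le> L2sq g" by simp
    then show ?thesis
      using pos by (simp add: pos_divide_le_eq power2_eq_square mult.commute)
  qed
  then show ?thesis by (simp add: z_def)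
qed

section \<open>Fourier series of periodic Sobolev functions\<close>

lemma H1perD:
  assumes "H1per u v"
  shows "v absolutely_integrable_on {0..2*pi}" "sq_integrable v"
    "\<And>x. x \<in> {0..2*pi} \<Longrightarrow> u x = u 0 + integral {0..x} v" "u (2*pi) = u 0"
    "continuous_on {0..2*pi} u" "sq_integrable u" "integral {0..2*pi} v = 0"
proof -
  note H = assms[unfolded H1per_def]
  show v: "v absolutely_integrable_on {0..2*pi}" and "sq_integrable v"
    using H unfolding sq_integrable_def by blast+
  show u: "\<And>x. x \<in> {0..2*pi} \<Longrightarrow> u x = u 0 + integral {0..x} v"
    using H by blast
  show p: "u (2*pi) = u 0"
    using H by (metis add_0)
  have "continuous_on {0..2*pi} (\<lambda>x. u 0 + integral {0..x} v)"
    using v unfolding absolutely_integrable_on_def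
    by (intro continuous_on_add continuous_on_const indefinite_integral_continuous_1) blast
  then show "continuous_on {0..2*pi} u"
    using u by (metis (mono_tags, lifting) continuous_on_cong)
  then show "sq_integrable u" by (rule sq_integrable_continuous)
  show "integral {0..2*pi} v = 0"
    using u[of "2*pi"] p by simp
qed

text \<open>Integration by parts against \<open>ek (-k)\<close>; the boundary terms cancel because
  both factors are periodic.\<close>

lemma fourier_coeff_derivative:
  assumes "H1per u v"
  shows "fourier_coeff v k = \<i> * of_int k * fourier_coeff u k"
proof -
  have "integral {0..2*pi} (\<lambda>x. ek (-k) x * v x) = ek (-k) (2*pi) * u (2*pi) - ek (-k) 0 * u 0
      - integral {0..2*pi} (\<lambda>x. (\<i> * of_int (-k) * ek (-k) x) * u x)"
    by (rule integral_by_parts_indefinite[OF _ H1perD(1,3)[OF assms] has_vector_derivative_ek])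
      (auto intro!: continuous_on_mult_left continuous_on_ek continuous_on_minus)
  also have "\<dots> = \<i> * of_int k * integral {0..2*pi} (\<lambda>x. ek (-k) x * u x)"
    using H1perD(4)[OF assms] by (simp add: mult.assoc)
  finally show ?thesis by (simp add: fourier_coeff_def)
qed

text \<open>Makes the exponentials available as derivatives in the sawtooth representation, from
  which the coefficients of the sawtooth are read off.\<close>

lemma H1per_ek:
  assumes "m \<noteq> 0"
  shows "H1per (\<lambda>x. ek m x / (\<i> * of_int m)) (ek m)"
  unfolding H1per_def
proof (intro conjI allI ballI)
  show "ek m absolutely_integrable_on {0..2*pi}" "(\<lambda>x. (cmod (ek m x))\<^sup>2) integrable_on {0..2*pi}"
    using sq_integrable_continuous[OF continuous_on_ek] unfolding sq_integrable_def by blast+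
  fix x :: real assume "x \<in> {0..2*pi}"
  then show "ek m x / (\<i> * of_int m) = ek m 0 / (\<i> * of_int m) + integral {0..x} (ek m)"
    using has_integral_ek[of x m] assms by (simp add: integral_unique diff_divide_distrib)
qed simp

section \<open>The sawtooth kernel and its Fourier coefficients\<close>

text \<open>As a function on the circle it has slope 1 and a single jump of -2 pi at
  \<open>y\<close>. Its distributional derivative is 1 minus 2 pi times the point mass at
  \<open>y\<close>, so it recovers point values of mean-zero functions from their
  derivatives.\<close>

definition saw :: "real \<Rightarrow> real \<Rightarrow> real" where
  "saw y x = x - 2 * pi * (if x \<in> {y..2*pi} then 1 else 0)"

text \<open>The linear part yields 2 pi u(0) by parts, as u has mean zero. The jump part yields 2 pi
  (u(y) - u(0)), as v has integral 0 over the period.\<close>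

lemma has_integral_saw:
  fixes u v :: "real \<Rightarrow> complex"
  assumes uv: "H1per u v" and u0: "integral {0..2*pi} u = 0" and y: "y \<in> {0..2*pi}"
  shows "((\<lambda>x. complex_of_real (saw y x) * v x) has_integral (2 * pi * u y)) {0..2*pi}"
proof -
  note H = H1perD[OF uv]
  have "integral {0..2*pi} (\<lambda>x. complex_of_real x * v x) = complex_of_real (2*pi) * u (2*pi) - complex_of_real 0 * u 0
      - integral {0..2*pi} (\<lambda>x. 1 * u x)"
  proof (rule integral_by_parts_indefinite[OF _ H(1,3)])
    show "(complex_of_real has_vector_derivative 1) (at x within {0..2*pi})" for x
      unfolding has_vector_derivative_def
      by (rule derivative_eq_intros refl | simp add: scaleR_conv_of_real)+
  qed auto
  moreover have "(\<lambda>x. complex_of_real x * v x) absolutely_integrable_on {0..2*pi}"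
    by (intro absolutely_integrable_continuous_mult H continuous_intros)
  ultimately have x: "((\<lambda>x. complex_of_real x * v x) has_integral (2 * pi * u 0)) {0..2*pi}"
    using H(4) u0 by (simp add: has_integral_iff absolutely_integrable_on_def)
  have vi: "v integrable_on {0..2*pi}" using H(1) unfolding absolutely_integrable_on_def by blast
  have "integral {0..y} v + integral {y..2*pi} v = 0"
    using Henstock_Kurzweil_Integration.integral_combine[of 0 y "2*pi" v] y vi H(7) by simp
  then have "integral {y..2*pi} v = - (u y - u 0)"
    using H(3)[OF y] by (simp add: add_eq_0_iff2)
  moreover have "v integrable_on {y..2*pi}"
    using integrable_subinterval_real[OF vi] y by simp
  ultimately have "(v has_integral (- (u y - u 0))) {y..2*pi}"
    by (simp add: has_integral_iff)
  then have "((\<lambda>x. if x \<in> {y..2*pi} then v x else 0) has_integral (- (u y - u 0))) {0..2*pi}"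
    using y by (subst has_integral_restrict) auto
  from has_integral_diff[OF x has_integral_mult_right[OF this, of "2*pi"]]
  show ?thesis
    by (rule has_integral_eq_rhs[OF has_integral_eq[rotated]])
       (auto simp: saw_def algebra_simps)
qed

text \<open>In the squared norm, the term with \<open>(y - pi)\<^sup>2\<close> is exactly the share
  of the constant mode; the rest does not depend on \<open>y\<close>.\<close>

lemma sq_integrable_saw:
  assumes y: "y \<in> {0..2*pi}"
  shows "sq_integrable (\<lambda>x. saw y x)"
    and "L2sq (\<lambda>x. saw y x) = 2*pi^3/3 + 2*pi*(y - pi)\<^sup>2"
    and "integral {0..2*pi} (\<lambda>x. complex_of_real (saw y x)) = 2*pi*(y - pi)"
proof -
  have ftc: "((\<lambda>x. x) has_integral (b\<^sup>2/2 - a\<^sup>2/2)) {a..b}"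
    "((\<lambda>x. x\<^sup>2) has_integral (b^3/3 - a^3/3)) {a..b}" "((\<lambda>x. c) has_integral (c * b - c * a)) {a..b}"
    if "a \<le> b" for a b c :: real
    by (rule fundamental_theorem_of_calculus[OF that],
       auto intro!: derivative_eq_intros simp: has_real_derivative_iff_has_vector_derivative[symmetric])+
  have r: "((\<lambda>x. if x \<in> {y..2*pi} then f x else 0) has_integral I) {0..2*pi}"
    if "(f has_integral I) {y..2*pi}" for f and I :: real
    using that y by (subst has_integral_restrict) auto
  have "((\<lambda>x. x - (if x \<in> {y..2*pi} then 2*pi else 0)) has_integral
      ((2*pi)\<^sup>2/2 - 0\<^sup>2/2 - ((2*pi) * (2*pi) - (2*pi)*y))) {0..2*pi}"
    using y by (intro has_integral_diff ftc r) auto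
  then have i1: "((\<lambda>x. saw y x) has_integral 2*pi*(y - pi)) {0..2*pi}"
    by (rule has_integral_eq_rhs[OF has_integral_eq[rotated]])
       (auto simp: saw_def algebra_simps power2_eq_square)
  have "((\<lambda>x. x\<^sup>2 - (if x \<in> {y..2*pi} then 4*pi*x - 4 * pi\<^sup>2 else 0)) has_integral
      ((2*pi)^3/3 - 0^3/3 - (4*pi*((2*pi)\<^sup>2/2 - y\<^sup>2/2) - ((4*pi\<^sup>2) * (2*pi) - (4*pi\<^sup>2) * y)))) {0..2*pi}"
    using y by (intro has_integral_diff ftc r has_integral_mult_right) auto
  then have "((\<lambda>x. (saw y x)\<^sup>2) has_integral (2*pi^3/3 + 2*pi*(y - pi)\<^sup>2)) {0..2*pi}"
    by (rule has_integral_eq_rhs[OF has_integral_eq[rotated]])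
       (auto simp: saw_def algebra_simps power2_eq_square power3_eq_cube)
  then have i2: "((\<lambda>x. (cmod (saw y x))\<^sup>2) has_integral (2*pi^3/3 + 2*pi*(y - pi)\<^sup>2)) {0..2*pi}"
    by (simp only: norm_of_real power2_abs)
  have ic: "((\<lambda>x. complex_of_real (saw y x)) has_integral complex_of_real (2*pi*(y - pi))) {0..2*pi}"
    using has_integral_of_real[OF i1] by simp
  show "sq_integrable (\<lambda>x. saw y x)"
    unfolding sq_integrable_def
  proof
    have "\<bar>saw y x\<bar> \<le> 4*pi" if "x \<in> {0..2*pi}" for x
      using that pi_gt_zero by (auto simp: saw_def)
    then show "(\<lambda>x. complex_of_real (saw y x)) absolutely_integrable_on {0..2*pi}"
      by (intro absolutely_integrable_integrable_bound[where g = "\<lambda>_. 4*pi"])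
        (use ic in \<open>auto simp: has_integral_integrable\<close>)
  qed (use i2 in blast)
  show "L2sq (\<lambda>x. saw y x) = 2*pi^3/3 + 2*pi*(y - pi)\<^sup>2"
    unfolding L2sq_def using i2 by (rule integral_unique)
  show "integral {0..2*pi} (\<lambda>x. complex_of_real (saw y x)) = 2*pi*(y - pi)"
    using ic by (rule integral_unique)
qed

text \<open>For nonzero k, the coefficient is the representation \<open>has_integral_saw\<close>
  applied to the antiderivative of \<open>ek (-k)\<close>.\<close>

lemma fourier_coeff_saw:
  assumes y: "y \<in> {0..2*pi}"
  shows "fourier_coeff (\<lambda>x. saw y x) 0 = y - pi"
    and "k \<noteq> 0 \<Longrightarrow> fourier_coeff (\<lambda>x. saw y x) k = - ek (-k) y / (\<i> * of_int k)"
proof -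
  show "fourier_coeff (\<lambda>x. saw y x) 0 = y - pi"
    using sq_integrable_saw(3)[OF y] by (simp add: fourier_coeff_def)
  assume k: "k \<noteq> 0"
  have "((\<lambda>x. complex_of_real (saw y x) * ek (-k) x) has_integral (2 * pi * (ek (-k) y / (\<i> * of_int (-k))))) {0..2*pi}"
  proof (rule has_integral_saw[OF H1per_ek])
    have "(ek (-k) has_integral 0) {0..2*pi}"
      using has_integral_ek_period[of "-k"] k by simp
    from has_integral_divide[OF this, of "\<i> * of_int (-k)"]
    show "integral {0..2*pi} (\<lambda>x. ek (- k) x / (\<i> * of_int (- k))) = 0"
      by (simp only: integral_unique div_0)
  qed (use k y in auto)
  then show "fourier_coeff (\<lambda>x. saw y x) k = - ek (-k) y / (\<i> * of_int k)"
    by (simp add: fourier_coeff_def integral_unique mult.commute)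
qed

section \<open>Convergence of the symmetric partial sums\<close>

definition nz_upto :: "nat \<Rightarrow> int set" where
  "nz_upto N = {- int N..int N} - {0}"

lemma finite_nz_upto [simp]: "finite (nz_upto N)"
  and zero_notin_nz_upto [simp]: "0 \<notin> nz_upto N"
  by (auto simp: nz_upto_def)

text \<open>The index n stands for the pair of frequencies n + 1 and -(n + 1). This shift by one is
  kept in all later series.\<close>

lemma sum_nz_upto:
  "(\<Sum>k\<in>nz_upto N. f k) = (\<Sum>n<N. f (int (Suc n)) + f (- int (Suc n)))"
proof (induction N)
  case (Suc N)
  have "nz_upto (Suc N) = insert (int (Suc N)) (insert (- int (Suc N)) (nz_upto N))"
    by (auto simp: nz_upto_def)
  then show ?case using Suc by (simp add: nz_upto_def add.assoc add.commute)
qed (simp add: nz_upto_def)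

lemma sum_nz_upto_uminus: "(\<Sum>k\<in>nz_upto N. f (- k)) = (\<Sum>k\<in>nz_upto N. f k)"
  by (simp add: sum_nz_upto add.commute)

text \<open>Squared L2 distance of \<open>saw y\<close> from its partial Fourier sum up to frequency
  N, the same for every \<open>y\<close> since the constant mode is removed.\<close>

definition saw_remainder :: "nat \<Rightarrow> real" where
  "saw_remainder N = 2*pi^3/3 - 4*pi * (\<Sum>n<N. 1 / (real n + 1)\<^sup>2)"

text \<open>The Basel series makes the two terms cancel: 4 pi times pi^2/6 is 2 pi^3/3.\<close>

lemma saw_remainder_tendsto: "saw_remainder \<longlonglongrightarrow> 0"
proof -
  have "saw_remainder \<longlonglongrightarrow> 2*pi^3/3 - 4*pi * (pi\<^sup>2 / 6)"
    unfolding saw_remainder_def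
    using inverse_squares_sums by (intro tendsto_intros) (simp add: sums_def add.commute)
  then show ?thesis by (simp add: power2_eq_square power3_eq_cube)
qed

text \<open>Replacing the sawtooth by its partial sum in the representation of 2 pi u(y) gives 2 pi
  times the partial Fourier sum of u at y. The error is the integral of the kernel remainder against
  v, bounded by Cauchy-Schwarz uniformly in y.\<close>

lemma fourier_partial_sum_error:
  assumes uv: "H1per u v" and u0: "integral {0..2*pi} u = 0" and y: "y \<in> {0..2*pi}"
  shows "(cmod (u y - (\<Sum>k\<in>nz_upto N. fourier_coeff u k * ek k y)))\<^sup>2
     \<le> saw_remainder N * L2sq v / (4 * pi\<^sup>2)"
proof -
  let ?K = "\<lambda>x. complex_of_real (saw y x)" and ?I = "insert 0 (nz_upto N)"
  let ?S = "\<lambda>x. \<Sum>k\<in>?I. fourier_coeff ?K k * ek k x"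
  note H = H1perD[OF uv]
  note B = bessel_identity[OF sq_integrable_saw(1)[OF y], of ?I]
  have rem: "L2sq (\<lambda>x. ?K x - ?S x) = saw_remainder N"
  proof -
    have "(\<Sum>k\<in>?I. (cmod (fourier_coeff ?K k))\<^sup>2) = (y - pi)\<^sup>2 + (\<Sum>k\<in>nz_upto N. 1 / (of_int k)\<^sup>2)"
    proof -
      have "(cmod (fourier_coeff ?K k))\<^sup>2 = 1 / (of_int k)\<^sup>2" if "k \<in> nz_upto N" for k
        using that fourier_coeff_saw(2)[OF y, of k]
        by (cases "k = 0") (auto simp: norm_divide norm_mult power_divide)
      moreover have "(cmod (fourier_coeff ?K 0))\<^sup>2 = (y - pi)\<^sup>2"
        unfolding fourier_coeff_saw(1)[OF y] by (simp flip: of_real_diff)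
      ultimately show ?thesis by simp
    qed
    also have "(\<Sum>k\<in>nz_upto N. 1 / (real_of_int k)\<^sup>2) = 2 * (\<Sum>n<N. 1 / (real n + 1)\<^sup>2)"
      unfolding sum_nz_upto sum_distrib_left
      by (intro sum.cong) (auto simp: power2_eq_square algebra_simps)
    finally show ?thesis
      using B sq_integrable_saw(2)[OF y] unfolding L2sq_def[of "\<lambda>x. ?K x - ?S x"] saw_remainder_def
      by (simp add: integral_unique algebra_simps)
  qed
  have "((\<lambda>x. \<Sum>k\<in>?I. fourier_coeff ?K k * (ek k x * v x)) has_integral
      (\<Sum>k\<in>?I. fourier_coeff ?K k * (2 * pi * fourier_coeff v (-k)))) {0..2*pi}"
    by (intro has_integral_sum has_integral_mult_right has_integral_fourier_coeff H) auto
  then have "((\<lambda>x. ?S x * v x) has_integral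
      (\<Sum>k\<in>?I. fourier_coeff ?K k * (2 * pi * fourier_coeff v (-k)))) {0..2*pi}"
    by (simp only: sum_distrib_right mult.assoc)
  \<comment> \<open>The constant mode drops out because the derivative has zero mean.\<close>
  also have "(\<Sum>k\<in>?I. fourier_coeff ?K k * (2 * pi * fourier_coeff v (-k))) =
    (\<Sum>k\<in>nz_upto N. fourier_coeff ?K k * (2 * pi * fourier_coeff v (-k)))"
    using fourier_coeff_derivative[OF uv, of 0] by simp
  \<comment> \<open>The factor 1/k of the sawtooth cancels the factor k from differentiation; the
    sign of k is then absorbed by the symmetry of the index set.\<close>
  also have "\<dots> = (\<Sum>k\<in>nz_upto N. 2 * pi * (fourier_coeff u (-k) * ek (-k) y))"
  proof (intro sum.cong refl)
    fix k assume "k \<in> nz_upto N"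
    then have "k \<noteq> 0" by auto
    then show "fourier_coeff ?K k * (2 * pi * fourier_coeff v (-k)) = 2 * pi * (fourier_coeff u (-k) * ek (-k) y)"
      using fourier_coeff_saw(2)[OF y] fourier_coeff_derivative[OF uv, of "-k"] by simp
  qed
  also have "\<dots> = 2 * pi * (\<Sum>k\<in>nz_upto N. fourier_coeff u k * ek k y)"
    using sum_nz_upto_uminus[of "\<lambda>k. 2 * pi * (fourier_coeff u k * ek k y)" N]
    by (simp add: sum_distrib_left)
  finally have "((\<lambda>x. ?K x * v x - ?S x * v x) has_integral
      (2 * pi * u y - 2 * pi * (\<Sum>k\<in>nz_upto N. fourier_coeff u k * ek k y))) {0..2*pi}"
    by (intro has_integral_diff has_integral_saw[OF uv u0 y])
  then have main: "((\<lambda>x. (?K x - ?S x) * v x) has_integral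
      (2 * pi * (u y - (\<Sum>k\<in>nz_upto N. fourier_coeff u k * ek k y)))) {0..2*pi}"
    by (simp only: left_diff_distrib right_diff_distrib)
  have "(cmod (integral {0..2*pi} (\<lambda>x. (?K x - ?S x) * v x)))\<^sup>2 \<le> L2sq (\<lambda>x. ?K x - ?S x) * L2sq v"
    using H(2) B main unfolding sq_integrable_def
    by (intro integral_cauchy_schwarz) (blast intro: has_integral_integrable finite_insert finite_nz_upto)+
  then have "(2 * pi)\<^sup>2 * (cmod (u y - (\<Sum>k\<in>nz_upto N. fourier_coeff u k * ek k y)))\<^sup>2
      \<le> saw_remainder N * L2sq v"
    unfolding integral_unique[OF main] rem by (simp add: norm_mult power_mult_distrib)
  then show ?thesis by (simp add: pos_le_divide_eq mult.commute)
qed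

lemma fourier_series_at_0:
  assumes "H1per u v" "integral {0..2*pi} u = 0"
  shows "(\<lambda>N. \<Sum>k\<in>nz_upto N. fourier_coeff u k) \<longlonglongrightarrow> u 0"
proof -
  have "(\<lambda>N. saw_remainder N * L2sq v / (4 * pi\<^sup>2)) \<longlonglongrightarrow> 0 * L2sq v / (4 * pi\<^sup>2)"
    by (intro tendsto_intros saw_remainder_tendsto) auto
  then have lim: "(\<lambda>N. saw_remainder N * L2sq v / (4 * pi\<^sup>2)) \<longlonglongrightarrow> 0"
    by simp
  have "(\<lambda>N. (cmod (u 0 - (\<Sum>k\<in>nz_upto N. fourier_coeff u k)))\<^sup>2) \<longlonglongrightarrow> 0"
    by (rule Lim_null_comparison[OF always_eventually lim])
      (use fourier_partial_sum_error[OF assms, of 0] in auto)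
  from tendsto_real_sqrt[OF this]
  have "(\<lambda>N. cmod (u 0 - (\<Sum>k\<in>nz_upto N. fourier_coeff u k))) \<longlonglongrightarrow> 0"
    by simp
  then show ?thesis
    by (subst Lim_null) (subst tendsto_norm_zero_iff[symmetric], simp add: norm_minus_commute)
qed

text \<open>Bessel bounds the partial sums from above. From below, the pointwise error bound is
  uniform in y and may be integrated over the period.\<close>

lemma parseval:
  assumes uv: "H1per u v" and u0: "integral {0..2*pi} u = 0"
  shows "(\<lambda>N. 2*pi * (\<Sum>k\<in>nz_upto N. (cmod (fourier_coeff u k))\<^sup>2)) \<longlonglongrightarrow> L2sq u"
proof -
  let ?r = "\<lambda>N. saw_remainder N * L2sq v / (4 * pi\<^sup>2)"
  have bd: "L2sq u - 2*pi * ?r N \<le> 2*pi * (\<Sum>k\<in>nz_upto N. (cmod (fourier_coeff u k))\<^sup>2)" for N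
  proof -
    have "L2sq u - 2*pi * (\<Sum>k\<in>nz_upto N. (cmod (fourier_coeff u k))\<^sup>2) \<le> 2*pi * ?r N"
      using bessel_identity[OF H1perD(6)[OF uv] finite_nz_upto]
    proof (rule has_integral_le)
      show "((\<lambda>x. ?r N) has_integral 2*pi * ?r N) {0..2*pi}"
        using has_integral_const_real[of "?r N" 0 "2*pi"] by simp
    qed
        (use fourier_partial_sum_error[OF uv u0] in auto)
    then show ?thesis by simp
  qed
  have "(\<lambda>N. L2sq u - 2*pi * ?r N) \<longlonglongrightarrow> L2sq u - 2*pi * (0 * L2sq v / (4 * pi\<^sup>2))"
    by (intro tendsto_intros saw_remainder_tendsto) auto
  then have "(\<lambda>N. L2sq u - 2*pi * ?r N) \<longlonglongrightarrow> L2sq u" by simp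
  then show ?thesis
    by (rule tendsto_sandwich[OF always_eventually always_eventually _ tendsto_const, rotated 2])
      (use bd bessel_inequality[OF H1perD(6)[OF uv]] in auto)
qed

section \<open>Bounds for the extremal problem\<close>

text \<open>Half of the sum over nonzero integers: k and -k are merged, so that
  \<open>GG m = inv_shift_sum m / pi\<close> for m > -1.\<close>

definition inv_shift_sum :: "real \<Rightarrow> real" where
  "inv_shift_sum m = (\<Sum>n. 1 / (m + (real n + 1)\<^sup>2))"

text \<open>For a > -1 the constant is positive and serves all m \<ge> a at once, which gives
  positivity, summability and the uniform majorant for the M-test.\<close>

lemma shifted_square_lower:
  assumes "a \<le> m"
  shows "min 1 (a + 1) * (real n + 1)\<^sup>2 \<le> m + (real n + 1)\<^sup>2"
proof (cases "a \<ge> 0")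
  case False
  have "1 \<le> (real n + 1)\<^sup>2" by (intro one_le_power) simp
  then have "a * (real n + 1)\<^sup>2 \<le> a * 1"
    using False by (intro mult_left_mono_neg) auto
  moreover have "min 1 (a + 1) * (real n + 1)\<^sup>2 = a * (real n + 1)\<^sup>2 + (real n + 1)\<^sup>2"
    using False by (simp add: distrib_right)
  ultimately show ?thesis
    using assms by linarith
qed (use assms in simp)

lemma shifted_square_pos: "m > -1 \<Longrightarrow> m + (real n + 1)\<^sup>2 > 0"
  using shifted_square_lower[of m m n]
  by (smt (verit) mult_pos_pos of_nat_0_le_iff zero_less_power)

lemma summable_inverse_squares: "summable (\<lambda>n. 1 / (real n + 1)\<^sup>2)"
  using inverse_squares_sums by (auto simp: sums_iff add.commute)

lemma summable_inv_shift:
  assumes "m > -1"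
  shows "summable (\<lambda>n. 1 / (m + (real n + 1)\<^sup>2))"
proof (rule summable_comparison_test'[where N = 0])
  show "summable (\<lambda>n. 1 / min 1 (m + 1) * (1 / (real n + 1)\<^sup>2))"
    by (intro summable_mult summable_inverse_squares)
  fix n
  have "0 < min 1 (m + 1) * (real n + 1)\<^sup>2" using assms by (intro mult_pos_pos) auto
  then show "norm (1 / (m + (real n + 1)\<^sup>2)) \<le> 1 / min 1 (m + 1) * (1 / (real n + 1)\<^sup>2)"
    using shifted_square_lower[of m m n] shifted_square_pos[OF assms, of n]
    by (simp add: frac_le)
qed

lemma inv_shift_sum_pos: "m > -1 \<Longrightarrow> inv_shift_sum m > 0"
  unfolding inv_shift_sum_def
  by (rule suminf_pos[OF summable_inv_shift]) (use shifted_square_pos in auto)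

text \<open>Weighted Cauchy-Schwarz for the coefficients up to frequency N, followed by N to
  infinity; the weights turn the second factor into m times the mass plus the energy.\<close>

lemma H1per_eval_bound:
  assumes uv: "H1per u v" and u0: "integral {0..2*pi} u = 0" and u1: "L2sq u = 1" and m: "m > -1"
  shows "(cmod (u 0))\<^sup>2 \<le> (m + L2sq v) * inv_shift_sum m / pi"
proof -
  let ?c = "fourier_coeff u"
  let ?P = "\<lambda>N. 2*pi * (\<Sum>k\<in>nz_upto N. (cmod (?c k))\<^sup>2)"
  let ?g = "\<lambda>N. \<Sum>n<N. 1 / (m + (real n + 1)\<^sup>2)"
  have pos: "m + (real_of_int k)\<^sup>2 > 0" if "k \<in> nz_upto N" for k N
  proof -
    have "1 \<le> \<bar>k\<bar>" using that by (auto simp: nz_upto_def)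
    then have "1 \<le> (real_of_int k)\<^sup>2"
      by (metis abs_ge_zero of_int_1_le_iff of_int_abs one_le_power power2_abs)
    with m show ?thesis by simp
  qed
  have fin: "(cmod (\<Sum>k\<in>nz_upto N. ?c k))\<^sup>2 \<le> ?g N * (m * ?P N + L2sq v) / pi" for N
  proof -
    have "(cmod (\<Sum>k\<in>nz_upto N. ?c k))\<^sup>2 \<le> (\<Sum>k\<in>nz_upto N. cmod (?c k))\<^sup>2"
      by (intro power_mono norm_sum) simp
    also have "\<dots> = (\<Sum>k\<in>nz_upto N. (1 / sqrt (m + (of_int k)\<^sup>2)) * (sqrt (m + (of_int k)\<^sup>2) * cmod (?c k)))\<^sup>2"
      by (intro arg_cong[where f = "\<lambda>x. x\<^sup>2"] sum.cong refl) (use pos in fastforce)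
    also have "\<dots> \<le> (\<Sum>k\<in>nz_upto N. (1 / sqrt (m + (of_int k)\<^sup>2))\<^sup>2) *
        (\<Sum>k\<in>nz_upto N. (sqrt (m + (of_int k)\<^sup>2) * cmod (?c k))\<^sup>2)"
      by (rule Cauchy_Schwarz_ineq_sum)
    also have "(\<Sum>k\<in>nz_upto N. (1 / sqrt (m + (of_int k)\<^sup>2))\<^sup>2) = (\<Sum>k\<in>nz_upto N. 1 / (m + (of_int k)\<^sup>2))"
      by (intro sum.cong refl) (use pos in \<open>auto simp: power_divide less_imp_le\<close>)
    also have "\<dots> = 2 * ?g N"
      unfolding sum_nz_upto sum_distrib_left
      by (intro sum.cong) (auto simp: power2_eq_square algebra_simps)
    also have "(\<Sum>k\<in>nz_upto N. (sqrt (m + (of_int k)\<^sup>2) * cmod (?c k))\<^sup>2) =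
        (\<Sum>k\<in>nz_upto N. m * (cmod (?c k))\<^sup>2 + (cmod (fourier_coeff v k))\<^sup>2)"
    proof (intro sum.cong refl)
      fix k assume "k \<in> nz_upto N"
      then show "(sqrt (m + (of_int k)\<^sup>2) * cmod (?c k))\<^sup>2 = m * (cmod (?c k))\<^sup>2 + (cmod (fourier_coeff v k))\<^sup>2"
        using pos[of k N] by (simp add: fourier_coeff_derivative[OF uv] norm_mult power_mult_distrib algebra_simps)
    qed
    also have "\<dots> = (m * ?P N + 2*pi * (\<Sum>k\<in>nz_upto N. (cmod (fourier_coeff v k))\<^sup>2)) / (2*pi)"
      by (simp add: sum.distrib sum_distrib_left[symmetric] field_simps)
    \<comment> \<open>For the energy Bessel's inequality suffices. The mass stays as
      \<open>?P N\<close> and is replaced by its limit 1 later, because an upper bound for it would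
      be useless when m is negative.\<close>
    also have "2 * ?g N * \<dots> \<le> 2 * ?g N * ((m * ?P N + L2sq v) / (2*pi))"
      using bessel_inequality[OF H1perD(2)[OF uv] finite_nz_upto] shifted_square_pos[OF m]
      by (intro mult_left_mono divide_right_mono add_left_mono mult_nonneg_nonneg sum_nonneg)
         (auto simp: less_imp_le)
    finally show ?thesis by simp
  qed
  have "?g \<longlonglongrightarrow> inv_shift_sum m"
    using summable_LIMSEQ[OF summable_inv_shift[OF m]] unfolding inv_shift_sum_def .
  then have "(\<lambda>N. ?g N * (m * ?P N + L2sq v) / pi) \<longlonglongrightarrow> inv_shift_sum m * (m * 1 + L2sq v) / pi"
    using parseval[OF uv u0] unfolding u1 by (intro tendsto_intros) auto
  moreover have "(\<lambda>N. (cmod (\<Sum>k\<in>nz_upto N. ?c k))\<^sup>2) \<longlonglongrightarrow> (cmod (u 0))\<^sup>2"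
    by (intro tendsto_intros fourier_series_at_0[OF uv u0])
  ultimately have "(cmod (u 0))\<^sup>2 \<le> inv_shift_sum m * (m * 1 + L2sq v) / pi"
    using fin by (intro LIMSEQ_le) auto
  then show ?thesis by (simp add: mult.commute)
qed

section \<open>Admissible trigonometric polynomials and bounds for the supremum\<close>

text \<open>The witness is the sum of 2 c_n cos((n+1)x) - 2 s_n sin((n+1)x). The sines count in both
  constraints but vanish at 0.\<close>

lemma trig_poly_admissible:
  assumes c1: "4*pi * (\<Sum>n<N. (c n)\<^sup>2 + (s n)\<^sup>2) = 1"
    and cD: "4*pi * (\<Sum>n<N. (real n + 1)\<^sup>2 * ((c n)\<^sup>2 + (s n)\<^sup>2)) = D"
  obtains u v where "H1per u v" "integral {0..2*pi} u = 0" "L2sq u = 1" "L2sq v = D"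
    "(cmod (u 0))\<^sup>2 = 4 * (\<Sum>n<N. c n)\<^sup>2"
proof -
  \<comment> \<open>Index \<open>nat \<bar>k\<bar> - 1\<close> belongs to frequency k, and the sign
    makes the coefficients of k and -k conjugate.\<close>
  define a where "a k = Complex (c (nat \<bar>k\<bar> - 1)) (of_int (sgn k) * s (nat \<bar>k\<bar> - 1))" for k :: int
  define u where "u x = (\<Sum>k\<in>nz_upto N. a k * ek k x)" for x
  define v where "v x = (\<Sum>k\<in>nz_upto N. (\<i> * of_int k * a k) * ek k x)" for x
  have a_Suc: "a (int (Suc n)) = Complex (c n) (s n)" "a (- int (Suc n)) = Complex (c n) (- s n)" for n
    by (simp_all add: a_def nat_add_distrib)
  have cont: "continuous_on S v" "continuous_on S u" for S
    unfolding u_def v_def by (intro continuous_on_sum continuous_on_mult_left continuous_on_ek)+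
  have deriv: "(u has_vector_derivative v x) (at x within S)" for x S
  proof -
    have "(u has_vector_derivative (\<Sum>k\<in>nz_upto N. a k * (\<i> * of_int k * ek k x))) (at x within S)"
      unfolding u_def by (intro has_vector_derivative_sum has_vector_derivative_mult_right has_vector_derivative_ek)
    then show ?thesis by (simp add: v_def mult_ac)
  qed
  show ?thesis
  proof
    show "H1per u v"
      unfolding H1per_def
    proof (intro conjI allI ballI)
      show "v absolutely_integrable_on {0..2*pi}" "(\<lambda>x. (cmod (v x))\<^sup>2) integrable_on {0..2*pi}"
        using sq_integrable_continuous[OF cont(1)] unfolding sq_integrable_def by blast+
      fix x :: real
      show "u (x + 2*pi) = u x" by (simp add: u_def)
      assume "x \<in> {0..2*pi}"
      then have "(v has_integral u x - u 0) {0..x}"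
        by (intro fundamental_theorem_of_calculus deriv) auto
      then show "u x = u 0 + integral {0..x} v" by (simp add: integral_unique)
    qed
    have "(u has_integral (\<Sum>k\<in>nz_upto N. a k * complex_of_real (if k = 0 then 2*pi else 0))) {0..2*pi}"
      unfolding u_def by (intro has_integral_sum has_integral_mult_right has_integral_ek_period) auto
    also have "(\<Sum>k\<in>nz_upto N. a k * complex_of_real (if k = 0 then 2*pi else 0)) = 0"
      by (intro sum.neutral) (auto simp: nz_upto_def)
    finally show "integral {0..2*pi} u = 0" by (rule integral_unique)
    have "L2sq u = 2*pi * (\<Sum>k\<in>nz_upto N. (cmod (a k))\<^sup>2)"
      unfolding L2sq_def u_def by (intro integral_unique has_integral_trig_sum_norm) simp
    also have "\<dots> = 4*pi * (\<Sum>n<N. (c n)\<^sup>2 + (s n)\<^sup>2)"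
      unfolding sum_nz_upto a_Suc by (simp add: cmod_power2 sum_distrib_left algebra_simps del: of_nat_Suc)
    finally show "L2sq u = 1" using c1 by simp
    have "L2sq v = 2*pi * (\<Sum>k\<in>nz_upto N. (cmod (\<i> * of_int k * a k))\<^sup>2)"
      unfolding L2sq_def v_def by (intro integral_unique has_integral_trig_sum_norm) simp
    also have "\<dots> = 2*pi * (\<Sum>k\<in>nz_upto N. (of_int k)\<^sup>2 * (cmod (a k))\<^sup>2)"
      by (simp add: norm_mult power_mult_distrib)
    also have "\<dots> = 4*pi * (\<Sum>n<N. (real n + 1)\<^sup>2 * ((c n)\<^sup>2 + (s n)\<^sup>2))"
    proof -
      have "(real_of_int (int (Suc n)))\<^sup>2 = (real n + 1)\<^sup>2" "(real_of_int (- int (Suc n)))\<^sup>2 = (real n + 1)\<^sup>2" for n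
        by (simp_all add: power2_eq_square algebra_simps)
      then show ?thesis unfolding sum_nz_upto a_Suc by (simp only:) (simp add: cmod_power2 sum_distrib_left algebra_simps)
    qed
    finally show "L2sq v = D" using cD by simp
    have "u 0 = (\<Sum>n<N. complex_of_real (2 * c n))"
      unfolding u_def sum_nz_upto a_Suc ek_at_0 by (intro sum.cong) (auto simp: complex_eq_iff)
    then have "u 0 = complex_of_real (2 * (\<Sum>n<N. c n))"
      by (simp add: sum_distrib_left)
    then show "(cmod (u 0))\<^sup>2 = 4 * (\<Sum>n<N. c n)\<^sup>2"
      by (simp only: norm_of_real power2_abs) (simp add: power_mult_distrib)
  qed
qed

text \<open>The admissible u rules out a supremum over the empty set, which would be unspecified.\<close>
lemma VV_upper:
  assumes "H1per u v" "integral {0..2*pi} u = 0" "L2sq u = 1" "L2sq v = D" "m > -1"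
  shows "VV D \<le> (m + D) * inv_shift_sum m / pi"
  unfolding VV_def by (rule cSup_least) (use assms H1per_eval_bound[OF _ _ _ \<open>m > -1\<close>] in blast)+

text \<open>The evaluation bound with shift 0 shows that the supremum is taken over a bounded
  set.\<close>

lemma VV_lower:
  assumes "H1per u v" "integral {0..2*pi} u = 0" "L2sq u = 1" "L2sq v = D"
  shows "(cmod (u 0))\<^sup>2 \<le> VV D"
  unfolding VV_def
proof (rule cSup_upper)
  show "bdd_above {(cmod (u 0))\<^sup>2 |u. \<exists>v. H1per u v \<and> integral {0..2*pi} u = 0 \<and> L2sq u = 1 \<and> L2sq v = D}"
    by (rule bdd_aboveI[where M = "(0 + D) * inv_shift_sum 0 / pi"])
      (use H1per_eval_bound[where m = 0] in fastforce)
qed (use assms in blast)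

text \<open>The sequence \<open>c\<close> describes a formal extremal with infinitely many cosine
  modes. Its truncation loses norm and energy; once these are restored the constraints hold exactly,
  while the value at 0 is still the truncated one. The same witness also serves for the upper
  bound.\<close>

lemma VV_bounds_of_coefficients:
  assumes c1: "(\<lambda>n. (c n)\<^sup>2) sums (1 / (4*pi))"
    and cD: "(\<lambda>n. (real n + 1)\<^sup>2 * (c n)\<^sup>2) sums (D / (4*pi))"
    and nz: "\<And>n. c n \<noteq> 0"
  shows "4 * (\<Sum>n<N. c n)\<^sup>2 \<le> VV D"
    and "m > -1 \<Longrightarrow> VV D \<le> (m + D) * inv_shift_sum m / pi"
proof -
  define \<epsilon> where "\<epsilon> = 1 / (4*pi) - (\<Sum>n<N. (c n)\<^sup>2)"
  define \<delta> where "\<delta> = D / (4*pi) - (\<Sum>n<N. (real n + 1)\<^sup>2 * (c n)\<^sup>2)"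
  have eps: "\<epsilon> > 0"
    using sum_less_suminf[OF sums_summable[OF c1], of N] nz sums_unique[OF c1] by (simp add: \<epsilon>_def)
  have diff: "(\<lambda>n. (real n + 1)\<^sup>2 * (c n)\<^sup>2 - (c n)\<^sup>2) sums (D / (4*pi) - 1 / (4*pi))"
    by (intro sums_diff c1 cD)
  have "0 \<le> (real n + 1)\<^sup>2 * (c n)\<^sup>2 - (c n)\<^sup>2" for n
    using mult_right_mono[OF one_le_power[of "real n + 1" 2], of "(c n)\<^sup>2"] by simp
  from sum_le_suminf[OF sums_summable[OF diff] finite_lessThan this]
  have "(\<Sum>n<N. (real n + 1)\<^sup>2 * (c n)\<^sup>2 - (c n)\<^sup>2) \<le> D / (4*pi) - 1 / (4*pi)"
    unfolding sums_unique[OF diff, symmetric] .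
  \<comment> \<open>All lost modes have frequency at least 1, so the lost energy is at least the
    lost norm.\<close>
  then have \<delta>: "\<delta> \<ge> \<epsilon>" by (simp add: \<epsilon>_def \<delta>_def sum_subtractf)
  \<comment> \<open>The first condition makes the second sine mode energetic enough; the second
    keeps the two modes distinct.\<close>
  obtain M where M: "real M \<ge> \<delta> / \<epsilon>" "M \<ge> 1"
    using real_arch_simple[of "max 1 (\<delta> / \<epsilon>)"] by auto
  txt \<open>Sine modes of frequencies 1 and M + 1 with masses p and q supply the missing norm \<epsilon> and the
    missing energy \<delta> without changing the value at 0.\<close>
  define F where "F = (real M + 1)\<^sup>2"
  have "F > 1" unfolding F_def using M by (intro one_less_power) auto
  have "\<delta> \<le> real M * \<epsilon>" using M eps by (simp add: divide_le_eq)
  also have "\<dots> \<le> F * \<epsilon>"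
    unfolding F_def using eps by (intro mult_right_mono) (auto simp: power2_eq_square algebra_simps)
  finally have "\<delta> \<le> F * \<epsilon>" .
  note F = \<open>F > 1\<close> this
  \<comment> \<open>Solution of p + q = \<epsilon> and p + F q = \<delta>. Here q \<ge> 0 follows
    from \<delta> \<ge> \<epsilon>, and p \<ge> 0 from \<delta> \<le> F \<epsilon>.\<close>
  define q where "q = (\<delta> - \<epsilon>) / (F - 1)"
  define p where "p = \<epsilon> - q"
  have q: "q \<ge> 0" using \<delta> F by (simp add: q_def)
  have p: "p \<ge> 0" using F by (simp add: p_def q_def divide_le_eq algebra_simps)
  have "(F - 1) * q = \<delta> - \<epsilon>" using F by (simp add: q_def)
  then have pq: "p + F * q = \<delta>" by (simp add: p_def algebra_simps)
  define c' where "c' n = (if n < N then c n else 0)" for n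
  define s where "s n = (if n = 0 then sqrt p else if n = M then sqrt q else 0)" for n
  define N' where "N' = N + M + 1"
  \<comment> \<open>Used with j = 1 for the value at 0 and j = 2 for the constraints; j > 0 makes
    the padded zeros vanish.\<close>
  have sumc: "(\<Sum>n<N'. f n * (c' n)^j) = (\<Sum>n<N. f n * (c n)^j)" if "j > 0" for f :: "nat \<Rightarrow> real" and j
    by (rule sum.mono_neutral_cong_right) (use that in \<open>auto simp: N'_def c'_def\<close>)
  have sums: "(\<Sum>n<N'. f n * (s n)\<^sup>2) = f 0 * p + f M * q" for f :: "nat \<Rightarrow> real"
  proof -
    have "(\<Sum>n<N'. f n * (s n)\<^sup>2) = (\<Sum>n\<in>{0, M}. f n * (s n)\<^sup>2)"
      by (rule sum.mono_neutral_right) (auto simp: N'_def s_def)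
    then show ?thesis using M p q by (simp add: s_def)
  qed
  have n1: "4*pi * (\<Sum>n<N'. (c' n)\<^sup>2 + (s n)\<^sup>2) = 1"
    using sumc[of 2 "\<lambda>_. 1"] sums[of "\<lambda>_. 1"]
    by (simp add: sum.distrib p_def \<epsilon>_def field_simps)
  have nD: "4*pi * (\<Sum>n<N'. (real n + 1)\<^sup>2 * ((c' n)\<^sup>2 + (s n)\<^sup>2)) = D"
    using sumc[of 2 "\<lambda>n. (real n + 1)\<^sup>2"] sums[of "\<lambda>n. (real n + 1)\<^sup>2"] pq
    unfolding F_def[symmetric]
    by (simp add: distrib_left sum.distrib \<delta>_def field_simps)
  obtain u v where uv: "H1per u v" "integral {0..2*pi} u = 0" "L2sq u = 1" "L2sq v = D"
    "(cmod (u 0))\<^sup>2 = 4 * (\<Sum>n<N'. c' n)\<^sup>2"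
    using trig_poly_admissible[OF n1 nD] by metis
  show "4 * (\<Sum>n<N. c n)\<^sup>2 \<le> VV D"
    using VV_lower[OF uv(1-4)] uv(5) sumc[of 1 "\<lambda>_. 1"] by simp
  show "VV D \<le> (m + D) * inv_shift_sum m / pi" if "m > -1"
    by (rule VV_upper[OF uv(1-4) that])
qed

section \<open>The stationary shift\<close>

text \<open>The derivative in l of (l + D) / (l + k^2) with k = n + 1. A vanishing sum also says
  that the coefficients 1 / (l + k^2) have energy-to-mass ratio D.\<close>

definition stationarity_term :: "real \<Rightarrow> real \<Rightarrow> nat \<Rightarrow> real" where
  "stationarity_term D l n = ((real n + 1)\<^sup>2 - D) / (l + (real n + 1)\<^sup>2)\<^sup>2"

lemma stationarity_term_bound:
  assumes "-1 < a" "a \<le> l" "D \<ge> 0"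
  shows "norm (stationarity_term D l n) \<le> (1 + D) / (min 1 (a + 1))\<^sup>2 * (1 / (real n + 1)\<^sup>2)"
proof -
  define d k where "d = min 1 (a + 1)" and "k = (real n + 1)\<^sup>2"
  have d: "d > 0" using assms by (simp add: d_def)
  have k: "k \<ge> 1" unfolding k_def by (intro one_le_power) simp
  have lk: "d * k \<le> l + k" unfolding d_def k_def by (rule shifted_square_lower[OF assms(2)])
  have "\<bar>k - D\<bar> / (l + k)\<^sup>2 \<le> (1 + D) * k / (d * k)\<^sup>2"
  proof (rule frac_le)
    show "\<bar>k - D\<bar> \<le> (1 + D) * k"
      using k assms(3) mult_left_mono[OF k assms(3)] by (simp add: algebra_simps)
    show "(d * k)\<^sup>2 \<le> (l + k)\<^sup>2" using lk d k by (intro power_mono) auto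
  qed (use d k assms in auto)
  also have "\<dots> = (1 + D) / d\<^sup>2 * (1 / k)"
    using k by (simp add: power2_eq_square)
  finally show ?thesis
    unfolding stationarity_term_def d_def[symmetric] k_def[symmetric] by simp
qed

lemma summable_stationarity_term:
  assumes "-1 < l" "D \<ge> 0"
  shows "summable (stationarity_term D l)"
  by (rule summable_comparison_test'[where N = 0, OF summable_mult[OF summable_inverse_squares]])
     (rule stationarity_term_bound[OF assms(1) order_refl assms(2)])

lemma continuous_on_stationarity_sum:
  assumes "-1 < a" "D \<ge> 0"
  shows "continuous_on {a..b} (\<lambda>l. \<Sum>n. stationarity_term D l n)"
proof (rule uniform_limit_theorem)
  show "uniform_limit {a..b} (\<lambda>N l. \<Sum>n<N. stationarity_term D l n) (\<lambda>l. \<Sum>n. stationarity_term D l n) sequentially"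
    by (rule Weierstrass_m_test[OF _ summable_mult[OF summable_inverse_squares]])
       (rule stationarity_term_bound, use assms in auto)
  have "l + (real n + 1)\<^sup>2 \<noteq> 0" if "l \<in> {a..b}" for l n
    using shifted_square_pos[of l n] assms that by auto
  then show "\<forall>\<^sub>F N in sequentially. continuous_on {a..b} (\<lambda>l. \<Sum>n<N. stationarity_term D l n)"
    unfolding stationarity_term_def
    by (intro always_eventually allI continuous_intros) auto
qed simp

text \<open>Common majorant for the next estimates: \<open>x\<close> is the contribution of n = 0,
  the only mode singular at -1, and the other modes are covered by twice the Basel series.\<close>

lemma sums_majorant:
  "(\<lambda>n. 2 * (1 / (real n + 1)\<^sup>2) + (if n = 0 then x else 0)) sums (2 * (pi\<^sup>2/6) + x)"
  using sums_single[of 0 "\<lambda>_. x"] inverse_squares_sums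
  by (intro sums_add sums_mult) (auto simp: add.commute)

lemma four_le_square: "n \<noteq> 0 \<Longrightarrow> 4 \<le> (real n + 1)\<^sup>2"
  using power_mono[of 2 "real n + 1" 2] by simp

text \<open>For D > 1 the right-hand side tends to minus infinity as l decreases to -1, which
  supplies the nonpositive end for the intermediate value theorem.\<close>

lemma stationarity_sum_le:
  assumes l: "-1 < l" and D: "D \<ge> 0"
  shows "(\<Sum>n. stationarity_term D l n) \<le> 2 * (pi\<^sup>2/6) + (1 - D) / (l + 1)\<^sup>2"
proof -
  have "stationarity_term D l n \<le> 2 * (1 / (real n + 1)\<^sup>2) + (if n = 0 then (1 - D) / (l + 1)\<^sup>2 else 0)" for n
  proof (cases "n = 0")
    case False
    define k where "k = (real n + 1)\<^sup>2"
    have k: "k \<ge> 4" unfolding k_def by (rule four_le_square[OF False])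
    have "(k - D) / (l + k)\<^sup>2 \<le> k / (k - 1)\<^sup>2"
      using k l D by (intro frac_le power_mono) auto
    also have "\<dots> \<le> 2 / k"
    proof -
      have "0 \<le> k * (k - 4)" using k by simp
      then have "k * k \<le> 2 * (k - 1)\<^sup>2" by (simp add: power2_eq_square algebra_simps)
      then show ?thesis using k by (simp add: divide_le_eq le_divide_eq)
    qed
    finally show ?thesis using False unfolding stationarity_term_def k_def by simp
  qed (simp add: stationarity_term_def)
  from suminf_le[OF this summable_stationarity_term[OF l D] sums_summable[OF sums_majorant]]
  show ?thesis unfolding sums_unique[OF sums_majorant, symmetric] .
qed

text \<open>The mode n = 0 carries the pole at -1; the others stay bounded since k^2 \<ge> 4
  there.\<close>

lemma inv_shift_sum_bounds:
  assumes m: "m > -1"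
  shows "1 / (m + 1) \<le> inv_shift_sum m" "inv_shift_sum m \<le> 2 * (pi\<^sup>2/6) + 1 / (m + 1)"
proof -
  show "1 / (m + 1) \<le> inv_shift_sum m"
    using sum_le_suminf[OF summable_inv_shift[OF m], of "{0}"] shifted_square_pos[OF m]
    by (auto simp: inv_shift_sum_def less_imp_le)
  have "1 / (m + (real n + 1)\<^sup>2) \<le> 2 * (1 / (real n + 1)\<^sup>2) + (if n = 0 then 1 / (m + 1) else 0)" for n
  proof (cases "n = 0")
    case False
    with four_le_square[OF False] m have "(real n + 1)\<^sup>2 \<le> 2 * (m + (real n + 1)\<^sup>2)"
       "0 < m + (real n + 1)\<^sup>2" by auto
    then have "1 / (m + (real n + 1)\<^sup>2) \<le> 2 * (1 / (real n + 1)\<^sup>2)"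
      by (simp add: divide_simps)
    then show ?thesis using False by simp
  qed simp
  from suminf_le[OF this summable_inv_shift[OF m] sums_summable[OF sums_majorant]]
  show "inv_shift_sum m \<le> 2 * (pi\<^sup>2/6) + 1 / (m + 1)"
    unfolding sums_unique[OF sums_majorant, symmetric] inv_shift_sum_def .
qed

text \<open>Multiplied by l^2, the first K terms tend to the sum of (n+1)^2 - D, which is positive
  for K > D. All terms from index K on are nonnegative.\<close>

lemma stationarity_sum_pos:
  assumes D: "D \<ge> 0"
  shows "\<forall>\<^sub>F l in at_top. 0 < (\<Sum>n. stationarity_term D l n)"
proof -
  obtain K where K: "real K > D" "K \<ge> 1"
    using reals_Archimedean2[of "max D 1"] by force
  \<comment> \<open>Since (n+1)^2 \<ge> 2n + 1, the sum of the first K squares is at least K^2,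
    which exceeds K D.\<close>
  have "(\<Sum>n<N. 2 * real n + 1) = (real N)\<^sup>2" for N
    by (induction N) (auto simp: power2_eq_square algebra_simps)
  then have "(real K)\<^sup>2 - K * D \<le> (\<Sum>n<K. (real n + 1)\<^sup>2 - D)"
    using sum_mono[of "{..<K}" "\<lambda>n. 2 * real n + 1" "\<lambda>n. (real n + 1)\<^sup>2"]
    by (simp add: sum_subtractf power2_eq_square algebra_simps)
  moreover have "0 < real K * (real K - D)" using K by simp
  ultimately have pos: "0 < (\<Sum>n<K. (real n + 1)\<^sup>2 - D)"
    by (simp add: power2_eq_square algebra_simps)
  have "((\<lambda>l::real. (l / (l + b))\<^sup>2) \<longlongrightarrow> 1) at_top" for b
    by real_asymp
  then have "((\<lambda>l. \<Sum>n<K. ((real n + 1)\<^sup>2 - D) * (l / (l + (real n + 1)\<^sup>2))\<^sup>2) \<longlongrightarrow>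
       (\<Sum>n<K. ((real n + 1)\<^sup>2 - D) * 1)) at_top"
    by (intro tendsto_sum tendsto_mult tendsto_const)
  then have "\<forall>\<^sub>F l in at_top. 0 < (\<Sum>n<K. ((real n + 1)\<^sup>2 - D) * (l / (l + (real n + 1)\<^sup>2))\<^sup>2)"
    using pos by (intro order_tendstoD) auto
  then show ?thesis
    using eventually_gt_at_top[of 0]
  proof eventually_elim
    case (elim l)
    have "(\<Sum>n<K. ((real n + 1)\<^sup>2 - D) * (l / (l + (real n + 1)\<^sup>2))\<^sup>2) = l\<^sup>2 * (\<Sum>n<K. stationarity_term D l n)"
      by (simp add: sum_distrib_left stationarity_term_def power_divide mult.commute)
    then have "0 < (\<Sum>n<K. stationarity_term D l n)"
      using elim by (simp add: zero_less_mult_iff)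
    also have "\<dots> \<le> (\<Sum>n. stationarity_term D l n)"
    proof (rule sum_le_suminf)
      fix n assume "n \<in> - {..<K}"
      then have "D \<le> real n + 1" using K by auto
      also have "\<dots> \<le> (real n + 1)\<^sup>2" by (simp add: power2_eq_square)
      finally show "0 \<le> stationarity_term D l n" by (simp add: stationarity_term_def)
    qed (use elim D summable_stationarity_term in auto)
    finally show ?case .
  qed
qed

lemma stationary_shift_exists:
  assumes "D > 1"
  obtains l where "l > -1" "(\<Sum>n. stationarity_term D l n) = 0"
proof -
  \<comment> \<open>The zero of the upper bound pi^2/3 + (1 - D)/t^2 for the sum at l = t -
    1.\<close>
  define t where "t = sqrt (3 * (D - 1) / pi\<^sup>2)"
  have t: "t > 0" "t\<^sup>2 = 3 * (D - 1) / pi\<^sup>2" using assms by (simp_all add: t_def)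
  have lo: "(\<Sum>n. stationarity_term D (t - 1) n) \<le> 0"
  proof -
    have "(\<Sum>n. stationarity_term D (t - 1) n) \<le> 2 * (pi\<^sup>2/6) + (1 - D) / t\<^sup>2"
      using stationarity_sum_le[of "t - 1" D] t(1) assms by simp
    also have "\<dots> = 0"
      unfolding t(2) using assms by (simp add: divide_simps) (simp add: algebra_simps)
    finally show ?thesis .
  qed
  have "\<forall>\<^sub>F l in at_top. t - 1 \<le> l \<and> 0 < (\<Sum>n. stationarity_term D l n)"
    using stationarity_sum_pos assms by (intro eventually_conj eventually_ge_at_top) auto
  then obtain b where b: "t - 1 \<le> b" "0 < (\<Sum>n. stationarity_term D b n)"
    using eventually_happens[of _ "at_top :: real filter"] by auto
  obtain l where "t - 1 \<le> l" "(\<Sum>n. stationarity_term D l n) = 0"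
    using IVT'[OF lo less_imp_le[OF b(2)] b(1) continuous_on_stationarity_sum] t assms by auto
  then show thesis using that[of l] t by simp
qed

section \<open>The sharp value for D > 1\<close>

text \<open>Coefficients proportional to 1 / (l + k^2) give equality in the weighted Cauchy-Schwarz
  inequality, and stationarity of l is what makes them meet the energy constraint.\<close>

lemma VV_eq_stationary:
  assumes D: "D > 1" and l: "l > -1" and st: "(\<Sum>n. stationarity_term D l n) = 0"
  shows "VV D = (l + D) * inv_shift_sum l / pi"
    and "m > -1 \<Longrightarrow> VV D \<le> (m + D) * inv_shift_sum m / pi"
proof -
  define a where "a n = 1 / (l + (real n + 1)\<^sup>2)" for n
  define g where "g = inv_shift_sum l"
  define A where "A = g / (l + D)"
  have lD: "l + D > 0" and g: "g > 0"
    using D l inv_shift_sum_pos[OF l] by (auto simp: g_def)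
  then have A: "A > 0" by (simp add: A_def)
  have a: "a n > 0" for n using shifted_square_pos[OF l] by (simp add: a_def)
  have ag: "a sums g"
    unfolding a_def g_def inv_shift_sum_def by (rule summable_sums[OF summable_inv_shift[OF l]])
  have "stationarity_term D l sums 0"
    using summable_sums[OF summable_stationarity_term[OF l, of D]] D st by simp
  from sums_diff[OF ag this]
  have "(\<lambda>n. a n - stationarity_term D l n) sums g" by simp
  \<comment> \<open>This identity converts stationarity into the mass A = g / (l + D); splitting off
    l times the mass then gives the energy D A.\<close>
  moreover have "a n - stationarity_term D l n = (l + D) * (a n)\<^sup>2" for n
    using shifted_square_pos[OF l, of n]
    by (simp add: a_def stationarity_term_def divide_simps) (simp add: power2_eq_square algebra_simps)
  ultimately have "(\<lambda>n. (l + D) * (a n)\<^sup>2) sums g" by simp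
  from sums_divide[OF this, of "l + D"] have a2: "(\<lambda>n. (a n)\<^sup>2) sums A"
    using lD by (simp add: A_def)
  have "(\<lambda>n. a n - l * (a n)\<^sup>2) sums (g - l * A)"
    by (intro sums_diff sums_mult ag a2)
  moreover have "a n - l * (a n)\<^sup>2 = (real n + 1)\<^sup>2 * (a n)\<^sup>2" for n
    using shifted_square_pos[OF l, of n]
    by (simp add: a_def divide_simps) (simp add: power2_eq_square algebra_simps)
  moreover have "g - l * A = D * A" using lD by (simp add: A_def field_simps)
  ultimately have ka2: "(\<lambda>n. (real n + 1)\<^sup>2 * (a n)\<^sup>2) sums (D * A)" by simp
  \<comment> \<open>Scaled so that the squares sum to 1 / (4 pi), the normalisation for half
    amplitudes of cosines.\<close>
  define c where "c n = a n / sqrt (4 * pi * A)" for n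
  have c2: "(c n)\<^sup>2 = (a n)\<^sup>2 / (4 * pi * A)" for n
    using A by (simp add: c_def power_divide)
  have s1: "(\<lambda>n. (c n)\<^sup>2) sums (1 / (4*pi))"
    using sums_divide[OF a2, of "4 * pi * A"] A by (simp add: c2)
  have sD: "(\<lambda>n. (real n + 1)\<^sup>2 * (c n)\<^sup>2) sums (D / (4*pi))"
    using sums_divide[OF ka2, of "4 * pi * A"] A by (simp add: c2)
  have nz: "c n \<noteq> 0" for n using a[of n] A by (simp add: c_def)
  note tr = VV_bounds_of_coefficients[OF s1 sD nz]
  show up: "m > -1 \<Longrightarrow> VV D \<le> (m + D) * inv_shift_sum m / pi" for m by (rule tr(2))
  have "(\<lambda>N. 4 * (\<Sum>n<N. c n)\<^sup>2) \<longlonglongrightarrow> 4 * (g / sqrt (4 * pi * A))\<^sup>2"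
    using sums_divide[OF ag, of "sqrt (4 * pi * A)"] unfolding c_def sums_def by (intro tendsto_intros)
  then have "4 * (g / sqrt (4 * pi * A))\<^sup>2 \<le> VV D"
    by (rule LIMSEQ_le_const2) (use tr(1) in blast)
  also have "4 * (g / sqrt (4 * pi * A))\<^sup>2 = (l + D) * g / pi"
    using A lD g by (simp add: power_divide) (simp add: A_def power2_eq_square)
  finally show "VV D = (l + D) * inv_shift_sum l / pi"
    using up[OF l] unfolding g_def by simp
qed

section \<open>The function to be minimised and its limit at -1\<close>

text \<open>All terms are positive, so the series converges unconditionally, and the nonzero
  integers split into two halves with equal sums.\<close>

lemma GG_eq:
  assumes l: "l > -1"
  shows "GG l = inv_shift_sum l / pi"
proof -
  let ?f = "\<lambda>k::int. 1 / (l + (of_int k)\<^sup>2)"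
  have hs: "((\<lambda>n. 1 / (l + (real n + 1)\<^sup>2)) has_sum inv_shift_sum l) UNIV"
    unfolding inv_shift_sum_def
    by (intro sums_nonneg_imp_has_sum summable_sums[OF summable_inv_shift[OF l]])
       (use shifted_square_pos[OF l] in \<open>auto simp: less_imp_le\<close>)
  have "(?f has_sum inv_shift_sum l) (range (\<lambda>n. int (Suc n)))"
    by (subst has_sum_reindex) (use hs in \<open>auto simp: o_def inj_on_def add.commute\<close>)
  moreover have "(?f has_sum inv_shift_sum l) (range (\<lambda>n. - int (Suc n)))"
  proof (subst has_sum_reindex)
    have "?f (- int (Suc n)) = 1 / (l + (real n + 1)\<^sup>2)" for n
      by (simp add: power2_eq_square algebra_simps)
    then show "((?f \<circ> (\<lambda>n. - int (Suc n))) has_sum inv_shift_sum l) UNIV"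
      using hs unfolding o_def by (simp only:)
  qed (auto simp: inj_on_def)
  ultimately have "(?f has_sum (inv_shift_sum l + inv_shift_sum l))
      (range (\<lambda>n. int (Suc n)) \<union> range (\<lambda>n. - int (Suc n)))"
    by (rule has_sum_Un_disjoint) auto
  also have "range (\<lambda>n. int (Suc n)) \<union> range (\<lambda>n. - int (Suc n)) = {k. k \<noteq> 0}"
  proof -
    have "k \<in> range (\<lambda>n. int (Suc n)) \<union> range (\<lambda>n. - int (Suc n))" if "k \<noteq> 0" for k
    proof (cases "k > 0")
      case True
      then have "k = int (Suc (nat k - 1))" by simp
      then show ?thesis by blast
    next
      case False
      with that have "k = - int (Suc (nat (- k) - 1))" by simp
      then show ?thesis by blast
    qed
    then show ?thesis by auto
  qed
  finally show ?thesis
    unfolding GG_def by (simp add: infsumI)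
qed

lemma FF_gt: "l > -1 \<Longrightarrow> FF D l = ereal ((l + D) * inv_shift_sum l / pi)"
  by (simp add: FF_def GG_eq)

text \<open>\<open>Lim\<close> has a known value only once a limit is exhibited; near -1 from the
  right, \<open>GG\<close> may be replaced by the one-sided series.\<close>

lemma FF_at_minus_one:
  assumes "((\<lambda>m. ereal ((m + D) * inv_shift_sum m / pi)) \<longlongrightarrow> L) (at_right (-1))"
  shows "FF D (-1) = L"
proof -
  have "\<forall>\<^sub>F m in at_right (-1). ereal ((m + D) * inv_shift_sum m / pi) = ereal ((m + D) * GG m)"
    using eventually_at_right_less[of "-1::real"] by eventually_elim (simp add: GG_eq)
  with assms have "((\<lambda>m. ereal ((m + D) * GG m)) \<longlongrightarrow> L) (at_right (-1))"
    by (rule Lim_transform_eventually)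
  then show ?thesis
    unfolding FF_def by (simp add: tendsto_Lim)
qed

text \<open>The pole 1 / (m + 1) of the lowest mode is multiplied by m + D \<ge> D - 1 > 0.\<close>

lemma FF_at_minus_one_gt:
  assumes "D > 1"
  shows "FF D (-1) = \<infinity>"
proof (rule FF_at_minus_one)
  have "filterlim (\<lambda>m::real. (D - 1) / pi * (1 / (m + 1))) at_top (at_right (-1))"
    using assms by real_asymp
  moreover have "\<forall>\<^sub>F m in at_right (-1). (D - 1) / pi * (1 / (m + 1)) \<le> (m + D) * inv_shift_sum m / pi"
    using eventually_at_right_less[of "-1::real"]
  proof eventually_elim
    case (elim m)
    have "(D - 1) * (1 / (m + 1)) \<le> (m + D) * inv_shift_sum m"
      using elim assms inv_shift_sum_bounds(1)[of m] by (intro mult_mono) auto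
    from divide_right_mono[OF this, of pi] show ?case by (simp add: mult.commute)
  qed
  ultimately have "filterlim (\<lambda>m. (m + D) * inv_shift_sum m / pi) at_top (at_right (-1))"
    by (rule filterlim_at_top_mono)
  then show "((\<lambda>m. ereal ((m + D) * inv_shift_sum m / pi)) \<longlongrightarrow> \<infinity>) (at_right (-1))"
    by (simp add: tendsto_PInfty_eq_at_top)
qed

text \<open>For D = 1 the factor m + 1 cancels the pole of the lowest mode exactly and kills the
  bounded rest.\<close>

lemma inv_shift_sum_residue:
  "((\<lambda>m. (m + 1) * inv_shift_sum m / pi) \<longlongrightarrow> 1 / pi) (at_right (-1))"
proof (rule tendsto_sandwich)
  show "\<forall>\<^sub>F m in at_right (-1). 1 / pi \<le> (m + 1) * inv_shift_sum m / pi"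
    using eventually_at_right_less[of "-1::real"]
    by eventually_elim (use inv_shift_sum_bounds(1) in \<open>auto simp: divide_simps mult.commute\<close>)
  show "\<forall>\<^sub>F m in at_right (-1). (m + 1) * inv_shift_sum m / pi \<le> ((m + 1) * (2 * (pi\<^sup>2/6)) + 1) / pi"
    using eventually_at_right_less[of "-1::real"]
  proof eventually_elim
    case (elim m)
    have "(m + 1) * inv_shift_sum m \<le> (m + 1) * (2 * (pi\<^sup>2/6) + 1 / (m + 1))"
      using elim inv_shift_sum_bounds(2)[of m] by (intro mult_left_mono) auto
    also have "\<dots> = (m + 1) * (2 * (pi\<^sup>2/6)) + 1"
      using elim by (simp add: distrib_left)
    finally show ?case by (simp add: divide_right_mono)
  qed
  have "((\<lambda>m::real. ((m + 1) * (2 * (pi\<^sup>2/6)) + 1) / pi) \<longlongrightarrow> ((-1 + 1) * (2 * (pi\<^sup>2/6)) + 1) / pi) (at_right (-1))"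
    by (intro tendsto_intros) auto
  then show "((\<lambda>m::real. ((m + 1) * (2 * (pi\<^sup>2/6)) + 1) / pi) \<longlongrightarrow> 1 / pi) (at_right (-1))"
    by simp
qed simp

section \<open>The case D = 1 and conclusion\<close>

lemma VV_one:
  shows "VV 1 = 1 / pi"
    and "m > -1 \<Longrightarrow> VV 1 \<le> (m + 1) * inv_shift_sum m / pi"
proof -
  define c :: "nat \<Rightarrow> real" where "c n = 1 / sqrt (4 * pi)" for n
  have c: "(c n)\<^sup>2 = 1 / (4 * pi)" for n by (simp add: c_def power_divide)
  \<comment> \<open>The single mode cos(x) / sqrt(pi), whose norm and energy are both 1.\<close>
  obtain u v where uv: "H1per u v" "integral {0..2*pi} u = 0" "L2sq u = 1" "L2sq v = 1"
      "(cmod (u 0))\<^sup>2 = 4 * (\<Sum>n<1. c n)\<^sup>2"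
    by (rule trig_poly_admissible[of c "\<lambda>_. 0" 1 1]) (auto simp: c)
  show up: "m > -1 \<Longrightarrow> VV 1 \<le> (m + 1) * inv_shift_sum m / pi" for m
    by (rule VV_upper[OF uv(1-4)])
  \<comment> \<open>No single m > -1 is used here: the upper bounds are passed to the limit m to
    -1.\<close>
  have "VV 1 \<le> 1 / pi"
    by (rule tendsto_lowerbound[OF inv_shift_sum_residue])
       (use eventually_at_right_less[of "-1::real"] up in \<open>auto elim: eventually_mono\<close>)
  moreover have "1 / pi \<le> VV 1"
    using VV_lower[OF uv(1-4)] uv(5) by (simp add: c)
  ultimately show "VV 1 = 1 / pi" by simp
qed

theorem theorem2p2:
  fixes D :: real
  assumes "D \<ge> 1"
  shows "\<exists>l\<ge>-1. FF D l = ereal (VV D) \<and> (\<forall>m\<ge>-1. FF D l \<le> FF D m)"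
proof (cases "D = 1")
  case True
  have F: "FF D (-1) = ereal (VV D)"
    unfolding True VV_one(1) by (rule FF_at_minus_one) (simp add: inv_shift_sum_residue)
  have "FF D (-1) \<le> FF D m" if "m \<ge> -1" for m
  proof (cases "m = -1")
    case False
    with that VV_one(2)[of m] show ?thesis
      unfolding F by (simp add: FF_gt True)
  qed simp
  with F show ?thesis by (intro exI[of _ "-1"]) simp
next
  case False
  then have D: "D > 1" using assms by simp
  obtain l where l: "l > -1" "(\<Sum>n. stationarity_term D l n) = 0"
    using stationary_shift_exists[OF D] .
  have F: "FF D l = ereal (VV D)"
    using VV_eq_stationary(1)[OF D l] by (simp add: FF_gt l)
  have "FF D l \<le> FF D m" if "m \<ge> -1" for m
  proof (cases "m = -1")
    case False
    with that VV_eq_stationary(2)[OF D l, of m] show ?thesis unfolding F by (simp add: FF_gt)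
  qed (simp add: FF_at_minus_one_gt[OF D])
  with F l show ?thesis by (intro exI[of _ l]) auto
qed

end
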